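(* Let $N\ge 2$. For each $x_0\in C_N^D$ there is a unique continuous function $x:[0,\infty[\to C_N^D$ with $x(0)=x_0$ such that $x(t)\in W_N^D$ for all $t\in\,]0,\infty[$ and such that $x:\,]0,\infty[\to W_N^D$ satisfies the ODE $$\frac{dx_i(t)}{dt}=\sum_{j\ne i}\Bigl(\frac{1}{x_i(t)-x_j(t)}+\frac{1}{x_i(t)+x_j(t)}\Bigr)\qquad (i=1,\ldots,N,\ t>0).$$
   Context: $C_N^D:=\{x\in\mathbb R^N:\ x_1\ge\cdots\ge x_{N-1}\ge |x_N|\}$ is the closed Weyl chamber of type $D_N$, and $W_N^D=\{x\in\mathbb R^N:\ x_1>\cdots>x_{N-1}>|x_N|\}$ is its interior. In sums $\sum_{j\neq i}$ the index $j$ runs over $\{1,\ldots,N\}\setminus\{i\}$. *)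

theory Defs
  imports "HOL-Analysis.Analysis"
begin

text \<open>
  The coordinates \<open>1 < \<dots> < N\<close> of \<open>\<real>\<^sup>N\<close> are indexed by an arbitrary finite linear order
  \<open>'n\<close> with \<open>N = CARD('n)\<close>; thus \<open>Max UNIV\<close> is the last index \<open>N\<close>. Each chain of inequalities
  is written with all pairs of its terms, not only the consecutive ones, since \<open>'n\<close> has no
  successor operation.
\<close>

definition weyl_chamber_D :: "(real ^ 'n::{finite,linorder}) set" where
  "weyl_chamber_D = {x. (\<forall>i j. i < j \<and> j < Max UNIV \<longrightarrow> x $ i \<ge> x $ j) \<and>
                        (\<forall>i < Max UNIV. x $ i \<ge> \<bar>x $ Max UNIV\<bar>)}"

definition open_weyl_chamber_D :: "(real ^ 'n::{finite,linorder}) set" where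
  "open_weyl_chamber_D = {x. (\<forall>i j. i < j \<and> j < Max UNIV \<longrightarrow> x $ i > x $ j) \<and>
                             (\<forall>i < Max UNIV. x $ i > \<bar>x $ Max UNIV\<bar>)}"

text \<open>
  Only the values of \<open>x\<close> on \<open>[0,\<infinity>[\<close> matter: for \<open>t > 0\<close> the two-sided derivative at \<open>t\<close> does
  not depend on the values of \<open>x\<close> at negative times.
\<close>

definition is_D_solution ::
    "real ^ 'n::{finite,linorder} \<Rightarrow> (real \<Rightarrow> real ^ 'n::{finite,linorder}) \<Rightarrow> bool" where
  "is_D_solution x0 x \<longleftrightarrow>
     continuous_on {0..} x \<and>
     (\<forall>t\<ge>0. x t \<in> weyl_chamber_D) \<and>
     x 0 = x0 \<and>
     (\<forall>t>0. x t \<in> open_weyl_chamber_D) \<and>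
     (\<forall>t>0. \<forall>i. ((\<lambda>s. x s $ i) has_real_derivative
        (\<Sum>j\<in>UNIV - {i}. 1 / (x t $ i - x t $ j) + 1 / (x t $ i + x t $ j))) (at t))"

end

theory Submission
  imports Defs
begin

text \<open>
  The right-hand side is the gradient of the concave function \<open>\<Sum>\<^sub>\<alpha> ln (\<alpha> \<bullet> x)\<close>, where \<open>\<alpha>\<close> runs over
  the positive roots \<open>e\<^sub>i \<plusminus> e\<^sub>j\<close> (\<open>i < j\<close>). As \<open>1 / u\<close> is decreasing, two solutions never move
  apart, which gives uniqueness. For existence replace \<open>1 / u\<close> by \<open>1 / max u \<epsilon>\<close>. The truncated field is Lipschitz, so it
  has global solutions from every point of the closed chamber, and they leave \<open>x0\<close> at a rate
  \<open>\<surd>t\<close> independent of \<open>\<epsilon>\<close>. The regularising effect of gradient flows bounds the truncated energy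
  from below at positive times uniformly in \<open>\<epsilon>\<close>, hence keeps the solutions away from the walls on
  every \<open>[s, T]\<close> with \<open>0 < s\<close>. For small \<open>\<epsilon>\<close> they therefore solve one and the same Lipschitz
  equation there, and contractivity makes them uniformly Cauchy on \<open>[0, T]\<close> as \<open>\<epsilon> \<rightarrow> 0\<close>.
\<close>

section \<open>Global solutions of Lipschitz equations\<close>

text \<open>Integrating \<open>C * exp (K * s)\<close> gains a factor \<open>1 / K\<close>, and the
  weight \<open>exp (- (K * t))\<close> cancels the remaining growth. This factor makes the Picard
  operator contract once \<open>K\<close> is large.\<close>

lemma exp_weighted_integral_bound:
  fixes g :: "real \<Rightarrow> 'a::banach"
  assumes "0 < K" "0 \<le> t" "continuous_on {0..t} g"
    and g: "\<And>s. s \<in> {0..t} \<Longrightarrow> norm (g s) \<le> C * exp (K * s)"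
  shows "norm (exp (- (K * t)) *\<^sub>R integral {0..t} g) \<le> C / K"
proof -
  have "((\<lambda>s. C * exp (K * s)) has_integral (C / K * exp (K * t) - C / K * exp (K * 0))) {0..t}"
    using assms(1,2)
    by (intro fundamental_theorem_of_calculus)
      (auto intro!: derivative_eq_intros simp flip: has_real_derivative_iff_has_vector_derivative)
  then have "integral {0..t} (\<lambda>s. C * exp (K * s)) = C / K * exp (K * t) - C / K"
    and "(\<lambda>s. C * exp (K * s)) integrable_on {0..t}"
    unfolding mult_zero_right exp_zero mult_1_right
    by (blast intro: integral_unique has_integral_integrable)+
  moreover have "g integrable_on {0..t}"
    using assms(3) by (rule integrable_continuous_real)
  ultimately have "norm (integral {0..t} g) \<le> C / K * exp (K * t) - C / K"
    using g Henstock_Kurzweil_Integration.integral_norm_bound_integral[of g "{0..t}" "\<lambda>s. C * exp (K * s)"] by metis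
  moreover have "0 \<le> C"
    using order_trans[OF norm_ge_zero g[of 0]] assms(2) by simp
  ultimately have "norm (integral {0..t} g) \<le> C / K * exp (K * t)"
    using assms(1) divide_nonneg_pos[of C K] by linarith
  then have "exp (- (K * t)) * norm (integral {0..t} g) \<le> exp (- (K * t)) * (C / K * exp (K * t))"
    by (intro mult_left_mono) auto
  also have "\<dots> = C / K"
    by (simp add: exp_minus field_simps)
  finally show ?thesis by simp
qed

text \<open>Bounded continuous functions live on the whole line, so \<open>max 0 t\<close> freezes
  the integral at negative times. On each ray \<open>{..<T}\<close> the function factors through the
  indefinite integral on \<open>{0..T}\<close>, and continuity is local.\<close>

lemma continuous_on_integral_max:
  fixes g :: "real \<Rightarrow> 'a::banach"
  assumes "continuous_on UNIV g"
  shows "continuous_on UNIV (\<lambda>t. integral {0..max 0 t} g)"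
proof -
  have "continuous_on {0..T} (\<lambda>t. integral {0..t} g)" for T
    by (intro indefinite_integral_continuous_1 integrable_continuous_real
        continuous_on_subset[OF assms]) auto
  then have cont: "continuous_on {..<T} (\<lambda>t. integral {0..max 0 t} g)" if "0 < T" for T
    by (rule continuous_on_compose2[where t = "{0..T}" and g = "\<lambda>t. integral {0..t} g" and f = "max 0"])
      (use that in \<open>auto intro!: continuous_intros\<close>)
  then have "continuous_on {..<\<bar>t\<bar> + 1} (\<lambda>t. integral {0..max 0 t} g)" for t
    using cont[of "\<bar>t\<bar> + 1"] by simp
  then have "isCont (\<lambda>t. integral {0..max 0 t} g) t" for t
    by (rule continuous_on_interior[of "{..<\<bar>t\<bar> + 1}"]) (auto simp: interior_open)
  then show ?thesis
    by (simp add: continuous_on_eq_continuous_at)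
qed

text \<open>Picard iteration in the weight \<open>exp (- K t)\<close>, which makes it a contraction of all of
  \<open>[0,\<infinity>[\<close> at once; the argument \<open>y\<close> stands for \<open>exp (- K t) (x t - x0)\<close>.\<close>

theorem lipschitz_ode_global_solution:
  fixes b :: "'a::banach \<Rightarrow> 'a"
  assumes "L-lipschitz_on UNIV b"
  obtains x where "x 0 = x0" "continuous_on {0..} x"
    "\<And>t. 0 < t \<Longrightarrow> (x has_vector_derivative b (x t)) (at t)"
proof -
  \<comment> \<open>The contraction constant will be \<open>L / K\<close>, which is at most 1/2; the
    summand 1 keeps \<open>K\<close> positive when \<open>L = 0\<close>.\<close>
  define K where "K = 2 * L + 1"
  have "0 \<le> L"
    using assms by (rule lipschitz_on_nonneg)
  then have K: "0 < K" "L / K \<le> 1 / 2"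
    by (auto simp: K_def divide_simps)
  have lip: "norm (b u - b v) \<le> L * norm (u - v)" for u v
    using lipschitz_onD[OF assms, of u v] by (simp add: dist_norm)
  have contb: "continuous_on UNIV b"
    using assms by (rule lipschitz_on_continuous_on)
  define g where "g y s = b (x0 + exp (K * s) *\<^sub>R apply_bcontfun y s)"
    for y :: "real \<Rightarrow>\<^sub>C 'a" and s
  define G where "G y t = exp (- (K * max 0 t)) *\<^sub>R integral {0..max 0 t} (g y)"
    for y t
  have contg: "continuous_on S (g y)" for y S
    unfolding g_def
    by (intro continuous_on_compose2[OF contb] continuous_intros) auto
  have contG: "continuous_on UNIV (G y)" for y
    unfolding G_def
    by (intro continuous_on_scaleR continuous_on_integral_max contg continuous_intros)
  have gdiff: "norm (g y s - g z s) \<le> L * dist y z * exp (K * s)" for y z s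
  proof -
    have "norm (g y s - g z s) \<le> L * norm (exp (K * s) *\<^sub>R (y s - z s))"
      unfolding g_def by (rule order_trans[OF lip]) (simp add: scaleR_right_diff_distrib)
    also have "\<dots> = L * exp (K * s) * dist (y s) (z s)"
      by (simp add: dist_norm)
    also have "\<dots> \<le> L * exp (K * s) * dist y z"
      using \<open>0 \<le> L\<close> by (intro mult_left_mono dist_bounded) auto
    finally show ?thesis
      by (simp add: mult_ac)
  qed
  have Gdiff: "dist (G y t) (G z t) \<le> L * dist y z / K" for y z t
  proof -
    have "G y t - G z t = exp (- (K * max 0 t)) *\<^sub>R integral {0..max 0 t} (\<lambda>s. g y s - g z s)"
      unfolding G_def
      by (subst Henstock_Kurzweil_Integration.integral_diff)
        (auto intro!: integrable_continuous_real contg simp: scaleR_right_diff_distrib)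
    then show ?thesis
      unfolding dist_norm[of "G y t"]
      using exp_weighted_integral_bound[OF K(1), of "max 0 t" "\<lambda>s. g y s - g z s", OF _ _ gdiff]
      by (simp add: continuous_on_diff contg)
  qed
  \<comment> \<open>At \<open>y = 0\<close> the integrand is the constant \<open>b x0\<close>.
    Together with \<open>Gdiff\<close> this bounds every \<open>G y\<close>, so the operator maps
    bounded continuous functions to themselves.\<close>
  have "norm (g 0 s) \<le> norm (b x0) * exp (K * s)" if "0 \<le> s" for s
    using that K(1) by (simp add: g_def zero_bcontfun.rep_eq mult_le_cancel_left1)
  then have G0: "norm (G 0 t) \<le> norm (b x0) / K" for t
    unfolding G_def using K(1) by (intro exp_weighted_integral_bound contg) auto
  have bdd: "G y \<in> bcontfun" for y
  proof -
    have "norm (G y t) \<le> norm (b x0) / K + L * dist y 0 / K" for t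
      using G0[of t] Gdiff[of y t 0] norm_triangle_sub[of "G y t" "G 0 t"]
      unfolding dist_norm[of "G y t"] by simp
    then show ?thesis
      using contG by (rule bcontfun_normI[rotated])
  qed
  have "dist (Bcontfun (G y)) (Bcontfun (G z)) \<le> 1 / 2 * dist y z" for y z
  proof (rule dist_bound)
    fix t
    have "dist (G y t) (G z t) \<le> L / K * dist y z"
      using Gdiff by simp
    also have "\<dots> \<le> 1 / 2 * dist y z"
      using K(2) by (intro mult_right_mono) auto
    finally show "dist (apply_bcontfun (Bcontfun (G y)) t) (apply_bcontfun (Bcontfun (G z)) t) \<le> 1 / 2 * dist y z"
      by (simp add: Bcontfun_inverse bdd)
  qed
  then have "\<exists>!y. Bcontfun (G y) = y"
    by (intro banach_fix_type[of "1 / 2"]) auto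
  then obtain y where "Bcontfun (G y) = y"
    by blast
  then have yG: "apply_bcontfun y t = G y t" for t
    using Bcontfun_inverse[OF bdd] by metis
  define x where "x t = x0 + exp (K * t) *\<^sub>R apply_bcontfun y t" for t
  have gx: "g y s = b (x s)" for s
    by (simp add: g_def x_def)
  have x: "x t = x0 + integral {0..t} (g y)" if "0 \<le> t" for t
    using that by (simp add: x_def yG G_def exp_minus max_absorb2)
  show ?thesis
  proof
    show "x 0 = x0"
      by (simp add: x)
    show "continuous_on {0..} x"
      unfolding x_def by (intro continuous_intros) auto
    show "(x has_vector_derivative b (x t)) (at t)" if "0 < t" for t
    proof -
      have "((\<lambda>u. x0 + integral {0..u} (g y)) has_vector_derivative b (x t)) (at t within {0..t + 1})"
        using that integral_has_vector_derivative[OF contg, of t 0 "t + 1" y]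
        by (auto intro!: derivative_eq_intros simp: gx)
      then have "((\<lambda>u. x0 + integral {0..u} (g y)) has_vector_derivative b (x t)) (at t within {0<..<t + 1})"
        by (rule has_vector_derivative_within_subset) auto
      then have "((\<lambda>u. x0 + integral {0..u} (g y)) has_vector_derivative b (x t)) (at t)"
        using that by (subst (asm) has_vector_derivative_within_open) auto
      then show ?thesis
        by (rule has_vector_derivative_transform_within_open[where S = "{0<..}"])
          (use that x in auto)
    qed
  qed
qed

section \<open>Truncation of the singularity\<close>

text \<open>\<open>trunc_ln\<close> continues \<open>ln\<close> along its tangent at \<open>\<epsilon>\<close>; it is the concave primitive of
  \<open>trunc_inverse\<close>.\<close>

definition trunc_inverse :: "real \<Rightarrow> real \<Rightarrow> real" where
  "trunc_inverse \<epsilon> u = 1 / max u \<epsilon>"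

definition trunc_ln :: "real \<Rightarrow> real \<Rightarrow> real" where
  "trunc_ln \<epsilon> u = (if \<epsilon> \<le> u then ln u else ln \<epsilon> + (u - \<epsilon>) / \<epsilon>)"

lemma trunc_inverse_eq: "\<epsilon> \<le> u \<Longrightarrow> trunc_inverse \<epsilon> u = 1 / u"
  by (simp add: trunc_inverse_def)

lemma trunc_inverse_nonneg: "0 < \<epsilon> \<Longrightarrow> 0 \<le> trunc_inverse \<epsilon> u"
  by (simp add: trunc_inverse_def)

lemma trunc_inverse_antimono: "0 < \<epsilon> \<Longrightarrow> u \<le> v \<Longrightarrow> trunc_inverse \<epsilon> v \<le> trunc_inverse \<epsilon> u"
  unfolding trunc_inverse_def by (intro divide_left_mono) auto

lemma trunc_inverse_mult_le: "0 < \<epsilon> \<Longrightarrow> trunc_inverse \<epsilon> u * u \<le> 1"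
  by (auto simp: trunc_inverse_def divide_simps)

lemma trunc_inverse_lipschitz:
  assumes "0 < \<epsilon>"
  shows "(1 / \<epsilon>\<^sup>2)-lipschitz_on UNIV (trunc_inverse \<epsilon>)"
proof (rule lipschitz_onI)
  fix u v :: real
  have "\<bar>1 / max u \<epsilon> - 1 / max v \<epsilon>\<bar> = \<bar>max v \<epsilon> - max u \<epsilon>\<bar> / (max u \<epsilon> * max v \<epsilon>)"
    using assms by (subst diff_frac_eq) (auto simp: abs_mult)
  also have "\<dots> \<le> \<bar>u - v\<bar> / (\<epsilon> * \<epsilon>)"
    using assms by (intro frac_le mult_mono mult_pos_pos) auto
  finally show "dist (trunc_inverse \<epsilon> u) (trunc_inverse \<epsilon> v) \<le> 1 / \<epsilon>\<^sup>2 * dist u v"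
    by (simp add: trunc_inverse_def dist_real_def power2_eq_square)
qed (use assms in simp)

text \<open>This is concavity. Where \<open>w\<close> and \<open>u\<close> lie on different sides of
  \<epsilon>, the tangent inequality of \<open>ln\<close> is used between \<epsilon> and the point
  above it; when \<open>w\<close> is the lower point, the slope \<open>1 / u\<close> is also
  compared with \<open>1 / \<epsilon>\<close>.\<close>

lemma trunc_ln_le_tangent:
  assumes "0 < \<epsilon>"
  shows "trunc_ln \<epsilon> w \<le> trunc_ln \<epsilon> u + trunc_inverse \<epsilon> u * (w - u)"
proof -
  have ln_le: "ln p \<le> ln q + (p - q) / q" if "0 < p" "0 < q" for p q :: real
    using ln_le_minus_one[of "p / q"] that by (simp add: ln_div diff_divide_distrib)
  consider "\<epsilon> \<le> w" "\<epsilon> \<le> u" | "\<epsilon> \<le> w" "u < \<epsilon>" | "w < \<epsilon>" "\<epsilon> \<le> u" | "w < \<epsilon>" "u < \<epsilon>"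
    by linarith
  then show ?thesis
  proof cases
    case 1
    then show ?thesis
      using ln_le[of w u] assms by (simp add: trunc_ln_def trunc_inverse_def)
  next
    case 2
    then show ?thesis
      using ln_le[of w \<epsilon>] assms by (simp add: trunc_ln_def trunc_inverse_def diff_divide_distrib)
  next
    case 3
    then have "(\<epsilon> - w) / u \<le> (\<epsilon> - w) / \<epsilon>"
      using assms by (intro divide_left_mono) auto
    then show ?thesis
      using 3 ln_le[of \<epsilon> u] assms by (simp add: trunc_ln_def trunc_inverse_def diff_divide_distrib)
  next
    case 4
    then show ?thesis
      using assms by (simp add: trunc_ln_def trunc_inverse_def diff_divide_distrib)
  qed
qed

text \<open>The tangent inequalities at \<open>u\<close> and at \<open>w\<close> squeeze the
  difference quotient between the values of \<open>trunc_inverse \<epsilon>\<close> at these points.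
  Continuity of that function then covers the junction at \<epsilon> without a case split.\<close>

lemma trunc_ln_has_derivative:
  assumes "0 < \<epsilon>"
  shows "(trunc_ln \<epsilon> has_real_derivative trunc_inverse \<epsilon> u) (at u)"
proof -
  have bound: "\<bar>(trunc_ln \<epsilon> w - trunc_ln \<epsilon> u) / (w - u) - trunc_inverse \<epsilon> u\<bar>
      \<le> \<bar>trunc_inverse \<epsilon> w - trunc_inverse \<epsilon> u\<bar>" if "w \<noteq> u" for w
  proof -
    define q where "q = (trunc_ln \<epsilon> w - trunc_ln \<epsilon> u) / (w - u)"
    then have q: "trunc_ln \<epsilon> w - trunc_ln \<epsilon> u = q * (w - u)"
      using that by simp
    have "q * (w - u) \<le> trunc_inverse \<epsilon> u * (w - u)"
      "trunc_inverse \<epsilon> w * (w - u) \<le> q * (w - u)"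
      using trunc_ln_le_tangent[OF assms, of w u] trunc_ln_le_tangent[OF assms, of u w]
      unfolding q[symmetric] by (simp_all add: algebra_simps)
    then show ?thesis
      using that unfolding q_def[symmetric] by (cases "u < w") (auto simp: mult_le_cancel_right)
  qed
  have "isCont (trunc_inverse \<epsilon>) u"
    using lipschitz_on_continuous_on[OF trunc_inverse_lipschitz[OF assms]]
    by (simp add: continuous_on_eq_continuous_at)
  then have "((\<lambda>w. \<bar>trunc_inverse \<epsilon> w - trunc_inverse \<epsilon> u\<bar>) \<longlongrightarrow> 0) (at u)"
    by (auto intro!: tendsto_eq_intros simp: isCont_def)
  then have "((\<lambda>w. (trunc_ln \<epsilon> w - trunc_ln \<epsilon> u) / (w - u) - trunc_inverse \<epsilon> u) \<longlongrightarrow> 0) (at u)"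
    by (rule Lim_null_comparison[rotated]) (auto simp: eventually_at_filter bound)
  then show ?thesis
    unfolding has_field_derivative_iff by (rule LIM_zero_cancel)
qed

lemma continuous_on_trunc_ln: "0 < \<epsilon> \<Longrightarrow> continuous_on S (trunc_ln \<epsilon>)"
  by (intro continuous_at_imp_continuous_on ballI DERIV_isCont[OF trunc_ln_has_derivative])

text \<open>The tangent at 1 gives the bound \<open>u - 1\<close>, because \<epsilon> is at most
  1.\<close>

lemma trunc_ln_le_abs:
  assumes "0 < \<epsilon>" "\<epsilon> \<le> 1"
  shows "trunc_ln \<epsilon> u \<le> \<bar>u\<bar>"
proof -
  have "trunc_ln \<epsilon> 1 = 0" "trunc_inverse \<epsilon> 1 = 1"
    using assms(2) by (simp_all add: trunc_ln_def trunc_inverse_eq)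
  then show ?thesis
    using trunc_ln_le_tangent[OF assms(1), of u 1] by simp
qed

text \<open>Below \<epsilon> the function stays under \<open>ln \<epsilon>\<close>, so the
  hypothesis forces \<open>u\<close> into the range where \<open>trunc_ln\<close> is
  \<open>ln\<close>. This turns a bound on one energy term into a distance from a wall that does not
  depend on \<epsilon>.\<close>

lemma ln_le_trunc_ln_imp_le:
  assumes "0 < \<epsilon>" "\<epsilon> \<le> \<delta>" "ln \<delta> \<le> trunc_ln \<epsilon> u"
  shows "\<delta> \<le> u"
proof -
  have "\<epsilon> \<le> u"
  proof (rule ccontr)
    assume u: "\<not> \<epsilon> \<le> u"
    then have "trunc_ln \<epsilon> u < ln \<epsilon>"
      using assms(1) by (simp add: trunc_ln_def divide_less_0_iff)
    also have "\<dots> \<le> ln \<delta>"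
      using assms(1,2) by simp
    finally show False
      using assms(3) by simp
  qed
  then show ?thesis
    using assms by (simp add: trunc_ln_def)
qed

lemma has_real_derivative_inner_self:
  assumes "(z has_vector_derivative z') (at t)"
  shows "((\<lambda>s. z s \<bullet> z s) has_real_derivative 2 * (z' \<bullet> z t)) (at t)"
proof -
  have "(z has_derivative (\<lambda>h. h *\<^sub>R z')) (at t)"
    using assms by (simp add: has_vector_derivative_def)
  from has_derivative_inner[OF this this] show ?thesis
    unfolding has_field_derivative_def
    by (rule has_derivative_eq_rhs) (simp add: inner_commute fun_eq_iff)
qed

section \<open>Flows driven by a finite family of walls\<close>

locale root_flow =
  fixes I :: "'i set" and a :: "'i \<Rightarrow> 'a::{real_inner,banach}"
  assumes finite_I: "finite I"
begin

text \<open>With \<open>f\<close> as a parameter, the singular field (\<open>f = inverse\<close>)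
  and its truncations share the same lemmas.\<close>

definition drift :: "(real \<Rightarrow> real) \<Rightarrow> 'a \<Rightarrow> 'a" where
  "drift f x = (\<Sum>i\<in>I. f (a i \<bullet> x) *\<^sub>R a i)"

definition solves :: "(real \<Rightarrow> real) \<Rightarrow> 'a \<Rightarrow> (real \<Rightarrow> 'a) \<Rightarrow> bool" where
  "solves f x0 x \<longleftrightarrow> x 0 = x0 \<and> continuous_on {0..} x \<and>
     (\<forall>t>0. (x has_vector_derivative drift f (x t)) (at t))"

text \<open>The concave potential whose gradient is
  \<open>drift (trunc_inverse \<epsilon>)\<close>.\<close>

definition energy :: "real \<Rightarrow> 'a \<Rightarrow> real" where
  "energy \<epsilon> x = (\<Sum>i\<in>I. trunc_ln \<epsilon> (a i \<bullet> x))"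

lemma drift_inner: "drift f x \<bullet> y = (\<Sum>i\<in>I. f (a i \<bullet> x) * (a i \<bullet> y))"
  by (simp add: drift_def inner_sum_left)

lemma drift_cong: "(\<And>i. i \<in> I \<Longrightarrow> f (a i \<bullet> x) = g (a i \<bullet> x)) \<Longrightarrow> drift f x = drift g x"
  by (simp add: drift_def)

text \<open>In \<open>norm (a i)\<close> squared, one factor comes from Cauchy-Schwarz for the
  argument of \<open>f\<close>, the other from the direction \<open>a i\<close> of the
  summand.\<close>

lemma drift_lipschitz:
  assumes "c-lipschitz_on UNIV f"
  shows "(\<Sum>i\<in>I. c * (norm (a i))\<^sup>2)-lipschitz_on UNIV (drift f)"
proof (rule lipschitz_onI)
  have "0 \<le> c"
    using assms by (rule lipschitz_on_nonneg)
  then show "0 \<le> (\<Sum>i\<in>I. c * (norm (a i))\<^sup>2)"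
    by (intro sum_nonneg) auto
  fix x y
  have "dist (drift f x) (drift f y) = norm (\<Sum>i\<in>I. (f (a i \<bullet> x) - f (a i \<bullet> y)) *\<^sub>R a i)"
    by (simp add: dist_norm drift_def scaleR_left_diff_distrib sum_subtractf)
  also have "\<dots> \<le> (\<Sum>i\<in>I. c * (norm (a i))\<^sup>2 * dist x y)"
  proof (rule sum_norm_le)
    fix i
    have "\<bar>f (a i \<bullet> x) - f (a i \<bullet> y)\<bar> \<le> c * \<bar>a i \<bullet> (x - y)\<bar>"
      using lipschitz_onD[OF assms, of "a i \<bullet> x" "a i \<bullet> y"] by (simp add: dist_real_def inner_diff_right)
    also have "\<dots> \<le> c * (norm (a i) * norm (x - y))"
      using \<open>0 \<le> c\<close> by (intro mult_left_mono Cauchy_Schwarz_ineq2)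
    finally have "\<bar>f (a i \<bullet> x) - f (a i \<bullet> y)\<bar> * norm (a i) \<le> c * (norm (a i) * norm (x - y)) * norm (a i)"
      by (rule mult_right_mono) simp
    then show "norm ((f (a i \<bullet> x) - f (a i \<bullet> y)) *\<^sub>R a i) \<le> c * (norm (a i))\<^sup>2 * dist x y"
      by (simp add: dist_norm power2_eq_square mult_ac)
  qed
  finally show "dist (drift f x) (drift f y) \<le> (\<Sum>i\<in>I. c * (norm (a i))\<^sup>2) * dist x y"
    by (simp add: sum_distrib_right)
qed

section \<open>Contraction and a priori estimates\<close>

text \<open>Half the derivative of the squared distance is a sum of products of an increment of
  \<open>f\<close> with the increment of its argument, each nonpositive for decreasing
  \<open>f\<close>. The set \<open>S\<close> allows for \<open>inverse\<close>, which decreases only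
  on the positive reals.\<close>

lemma drift_contraction:
  assumes "s \<le> t" "continuous_on {s..t} x" "continuous_on {s..t} y"
    and x: "\<And>r. s < r \<Longrightarrow> r < t \<Longrightarrow> (x has_vector_derivative drift f (x r)) (at r)"
    and y: "\<And>r. s < r \<Longrightarrow> r < t \<Longrightarrow> (y has_vector_derivative drift f (y r)) (at r)"
    and S: "\<And>r i. s < r \<Longrightarrow> r < t \<Longrightarrow> i \<in> I \<Longrightarrow> a i \<bullet> x r \<in> S \<and> a i \<bullet> y r \<in> S"
    and f: "\<And>u v. u \<in> S \<Longrightarrow> v \<in> S \<Longrightarrow> u \<le> v \<Longrightarrow> f v \<le> f u"
  shows "norm (x t - y t) \<le> norm (x s - y s)"
proof -
  have "(x t - y t) \<bullet> (x t - y t) \<le> (x s - y s) \<bullet> (x s - y s)"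
  proof (rule DERIV_nonpos_imp_decreasing_open[where f = "\<lambda>r::real. (x r - y r) \<bullet> (x r - y r)"])
    show "continuous_on {s..t} (\<lambda>r. (x r - y r) \<bullet> (x r - y r))"
      by (intro continuous_intros assms(2,3))
    fix r assume r: "s < r" "r < t"
    let ?D = "drift f (x r) - drift f (y r)"
    have "((\<lambda>r. (x r - y r) \<bullet> (x r - y r)) has_real_derivative 2 * (?D \<bullet> (x r - y r))) (at r)"
      by (intro has_real_derivative_inner_self has_vector_derivative_diff x[OF r] y[OF r])
    moreover have "?D \<bullet> (x r - y r)
        = (\<Sum>i\<in>I. (f (a i \<bullet> x r) - f (a i \<bullet> y r)) * (a i \<bullet> x r - a i \<bullet> y r))"
      by (simp add: inner_diff_left drift_inner inner_diff_right algebra_simps sum_subtractf sum.distrib)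
    moreover have "\<dots> \<le> 0"
    proof (rule sum_nonpos)
      fix i assume "i \<in> I"
      then show "(f (a i \<bullet> x r) - f (a i \<bullet> y r)) * (a i \<bullet> x r - a i \<bullet> y r) \<le> 0"
        using S[OF r] f by (cases "a i \<bullet> x r" "a i \<bullet> y r" rule: le_cases) (auto simp: mult_le_0_iff)
    qed
    ultimately show "\<exists>d. ((\<lambda>r. (x r - y r) \<bullet> (x r - y r)) has_real_derivative d) (at r) \<and> d \<le> 0"
      by auto
  qed (use assms in simp)
  then show ?thesis
    by (simp add: norm_le)
qed

text \<open>Each wall contributes at most 1 to half the derivative of the squared distance from
  \<open>x0\<close>: \<open>trunc_inverse \<epsilon> u * u\<close> is at most 1, and the term with
  \<open>x0\<close> has the right sign in the closed chamber. The bound controls all truncations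
  near time 0.\<close>

lemma dist_initial_le:
  fixes t :: real
  assumes "0 < \<epsilon>" "solves (trunc_inverse \<epsilon>) x0 x" "0 \<le> t"
    and x0: "\<And>i. i \<in> I \<Longrightarrow> 0 \<le> a i \<bullet> x0"
  shows "norm (x t - x0) \<le> sqrt (2 * real (card I) * t)"
proof -
  have "(x t - x0) \<bullet> (x t - x0) - 2 * real (card I) * t \<le> (x 0 - x0) \<bullet> (x 0 - x0) - 2 * real (card I) * 0"
  proof (rule DERIV_nonpos_imp_decreasing_open[where f = "\<lambda>r::real. (x r - x0) \<bullet> (x r - x0) - 2 * real (card I) * r"])
    have "continuous_on {0..t} x"
      using assms(2) by (auto simp: solves_def intro: continuous_on_subset)
    then show "continuous_on {0..t} (\<lambda>r. (x r - x0) \<bullet> (x r - x0) - 2 * real (card I) * r)"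
      by (intro continuous_intros)
    fix r :: real assume r: "0 < r"
    let ?D = "drift (trunc_inverse \<epsilon>) (x r)"
    have "(x has_vector_derivative ?D) (at r)"
      using assms(2) r by (simp add: solves_def)
    then have "((\<lambda>r. x r - x0) has_vector_derivative ?D) (at r)"
      by (simp add: has_vector_derivative_diff_const)
    from has_real_derivative_inner_self[OF this]
    have "((\<lambda>r. (x r - x0) \<bullet> (x r - x0) - 2 * real (card I) * r) has_real_derivative
        2 * (?D \<bullet> (x r - x0)) - 2 * real (card I)) (at r)"
      by (auto intro!: derivative_eq_intros)
    moreover have "?D \<bullet> (x r - x0) \<le> (\<Sum>i\<in>I. 1)"
      unfolding drift_inner
    proof (rule sum_mono)
      fix i assume "i \<in> I"
      then show "trunc_inverse \<epsilon> (a i \<bullet> x r) * (a i \<bullet> (x r - x0)) \<le> 1"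
        using trunc_inverse_mult_le[OF assms(1), of "a i \<bullet> x r"]
          mult_nonneg_nonneg[OF trunc_inverse_nonneg[OF assms(1), of "a i \<bullet> x r"] x0[OF \<open>i \<in> I\<close>]]
        by (simp add: inner_diff_right right_diff_distrib)
    qed
    ultimately show "\<exists>d. ((\<lambda>r. (x r - x0) \<bullet> (x r - x0) - 2 * real (card I) * r) has_real_derivative d) (at r) \<and> d \<le> 0"
      by auto
  qed (use assms in simp)
  moreover have "x 0 = x0"
    using assms(2) by (simp add: solves_def)
  ultimately show ?thesis
    by (simp add: norm_eq_sqrt_inner)
qed

text \<open>Regularising effect of the gradient flow of the concave function \<open>energy \<epsilon>\<close>: concavity makes
  \<open>norm (x r - v)\<^sup>2 / 2 + r * (energy \<epsilon> v - energy \<epsilon> (x r))\<close> nonincreasing in \<open>r\<close>.\<close>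

lemma energy_lower_bound:
  fixes t :: real
  assumes "0 < \<epsilon>" "solves (trunc_inverse \<epsilon>) x0 x" "0 < t"
  shows "energy \<epsilon> v - (norm (x0 - v))\<^sup>2 / (2 * t) \<le> energy \<epsilon> (x t)"
proof -
  let ?g = "\<lambda>r::real. (x r - v) \<bullet> (x r - v) / 2 + r * (energy \<epsilon> v - energy \<epsilon> (x r))"
  have "?g t \<le> ?g 0"
  proof (rule DERIV_nonpos_imp_decreasing_open[where f = ?g])
    have "continuous_on {0..t} x"
      using assms(2) by (auto simp: solves_def intro: continuous_on_subset)
    then show "continuous_on {0..t} ?g"
      unfolding energy_def
      by (intro continuous_intros continuous_on_compose2[OF continuous_on_trunc_ln[OF assms(1), of UNIV]])
         auto
    fix r :: real assume r: "0 < r"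
    let ?D = "drift (trunc_inverse \<epsilon>) (x r)"
    have x: "(x has_vector_derivative ?D) (at r)"
      using assms(2) r by (simp add: solves_def)
    have "((\<lambda>r. trunc_ln \<epsilon> (a i \<bullet> x r)) has_real_derivative
        trunc_inverse \<epsilon> (a i \<bullet> x r) * (a i \<bullet> ?D)) (at r)" for i
    proof (rule DERIV_chain2[OF trunc_ln_has_derivative[OF assms(1)]])
      show "((\<lambda>r. a i \<bullet> x r) has_real_derivative a i \<bullet> ?D) (at r)"
        using x unfolding has_vector_derivative_def has_field_derivative_def
        by (auto intro!: derivative_eq_intros simp: fun_eq_iff)
    qed
    then have dE: "((\<lambda>r. energy \<epsilon> (x r)) has_real_derivative ?D \<bullet> ?D) (at r)"
      unfolding energy_def drift_inner by (rule DERIV_sum)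
    have "((\<lambda>r. x r - v) has_vector_derivative ?D) (at r)"
      using x by (simp add: has_vector_derivative_diff_const)
    then have dN: "((\<lambda>r. (x r - v) \<bullet> (x r - v) / 2) has_real_derivative ?D \<bullet> (x r - v)) (at r)"
      using DERIV_cdivide[OF has_real_derivative_inner_self, of _ _ _ 2] by fastforce
    have "(?g has_real_derivative
        ?D \<bullet> (x r - v) + (energy \<epsilon> v - energy \<epsilon> (x r) - r * (?D \<bullet> ?D))) (at r)"
      by (rule DERIV_cong[OF DERIV_add[OF dN DERIV_mult[OF DERIV_ident
              DERIV_diff[OF DERIV_const dE]]]]) simp
    \<comment> \<open>Tangent inequalities summed over the walls: the energy difference cancels
      against the inner product with \<open>x r - v\<close>, leaving only minus \<open>r\<close>
      times the squared norm of the drift.\<close>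
    moreover have "energy \<epsilon> v \<le> (\<Sum>i\<in>I. trunc_ln \<epsilon> (a i \<bullet> x r)
        + trunc_inverse \<epsilon> (a i \<bullet> x r) * (a i \<bullet> (v - x r)))"
      unfolding energy_def using trunc_ln_le_tangent[OF assms(1)]
      by (intro sum_mono) (simp add: inner_diff_right)
    then have "energy \<epsilon> v \<le> energy \<epsilon> (x r) + ?D \<bullet> (v - x r)"
      by (simp add: energy_def drift_inner sum.distrib)
    then have "?D \<bullet> (x r - v) + (energy \<epsilon> v - energy \<epsilon> (x r) - r * (?D \<bullet> ?D)) \<le> 0"
      using mult_nonneg_nonneg[OF less_imp_le[OF r] inner_ge_zero[of ?D]]
      by (simp add: inner_diff_right)
    ultimately show "\<exists>d. (?g has_real_derivative d) (at r) \<and> d \<le> 0"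
      by blast
  qed (use assms(3) in simp)
  moreover have "x 0 = x0"
    using assms(2) by (simp add: solves_def)
  ultimately have "t * (energy \<epsilon> v - energy \<epsilon> (x t)) \<le> (norm (x0 - v))\<^sup>2 / 2"
    using inner_ge_zero[of "x t - v"] by (simp add: power2_norm_eq_inner del: inner_ge_zero)
  then have "energy \<epsilon> v - energy \<epsilon> (x t) \<le> (norm (x0 - v))\<^sup>2 / 2 / t"
    using assms(3) by (simp add: pos_le_divide_eq mult.commute)
  then show ?thesis
    by simp
qed

text \<open>The energy is bounded below at time \<open>t\<close> and each of its terms is bounded above, so no term can
  be very negative.\<close>

lemma uniform_gap:
  assumes v: "\<And>i. i \<in> I \<Longrightarrow> 0 < a i \<bullet> v"
    and x0: "\<And>i. i \<in> I \<Longrightarrow> 0 \<le> a i \<bullet> x0"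
    and "0 < s"
  obtains \<delta> where "0 < \<delta>"
    "\<And>\<epsilon> x t i. 0 < \<epsilon> \<Longrightarrow> \<epsilon> \<le> \<delta> \<Longrightarrow> solves (trunc_inverse \<epsilon>) x0 x \<Longrightarrow> s \<le> t \<Longrightarrow> t \<le> T
       \<Longrightarrow> i \<in> I \<Longrightarrow> \<delta> \<le> a i \<bullet> x t"
proof -
  \<comment> \<open>The energy of \<open>v\<close>, minus the regularisation loss at time
    \<open>s\<close> (the worst in the range), minus upper bounds for all the energy terms up to
    time \<open>T\<close>.\<close>
  define A where "A = (\<Sum>i\<in>I. ln (a i \<bullet> v)) - (norm (x0 - v))\<^sup>2 / (2 * s)
    - (\<Sum>i\<in>I. norm (a i) * (norm x0 + sqrt (2 * real (card I) * T)))"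
  \<comment> \<open>For \<epsilon> up to \<mu> the truncation is inactive at \<open>v\<close>, so
    the energy of \<open>v\<close> does not depend on \<epsilon>. Inserting 1 covers an empty
    \<open>I\<close> and gives the bound on \<epsilon> that \<open>trunc_ln_le_abs\<close> asks
    for.\<close>
  define \<mu> where "\<mu> = Min (insert 1 ((\<lambda>i. a i \<bullet> v) ` I))"
  have \<mu>: "0 < \<mu>" "\<mu> \<le> 1" "\<And>i. i \<in> I \<Longrightarrow> \<mu> \<le> a i \<bullet> v"
    using v finite_I by (auto simp: \<mu>_def)
  show ?thesis
  proof
    show "0 < min \<mu> (exp A)"
      using \<mu>(1) by simp
    fix \<epsilon> x t i
    assume \<epsilon>: "0 < \<epsilon>" "\<epsilon> \<le> min \<mu> (exp A)" and x: "solves (trunc_inverse \<epsilon>) x0 x"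
      and t: "s \<le> t" "t \<le> T" and i: "i \<in> I"
    have upper: "trunc_ln \<epsilon> (a j \<bullet> x t) \<le> norm (a j) * (norm x0 + sqrt (2 * real (card I) * T))" for j
    proof -
      have "norm (x t) \<le> norm x0 + norm (x t - x0)"
        by (rule norm_triangle_sub)
      also have "norm (x t - x0) \<le> sqrt (2 * real (card I) * t)"
        using dist_initial_le[OF \<epsilon>(1) x _ x0, of t] t \<open>0 < s\<close> by simp
      also have "\<dots> \<le> sqrt (2 * real (card I) * T)"
        using t by (intro real_sqrt_le_mono mult_left_mono) auto
      finally have "norm (a j) * norm (x t) \<le> norm (a j) * (norm x0 + sqrt (2 * real (card I) * T))"
        by (simp add: mult_left_mono)
      moreover have "trunc_ln \<epsilon> (a j \<bullet> x t) \<le> \<bar>a j \<bullet> x t\<bar>"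
        using \<epsilon> \<mu>(2) by (intro trunc_ln_le_abs) auto
      ultimately show ?thesis
        using Cauchy_Schwarz_ineq2[of "a j" "x t"] by linarith
    qed
    have "energy \<epsilon> v = (\<Sum>i\<in>I. ln (a i \<bullet> v))"
      unfolding energy_def
    proof (rule sum.cong)
      fix j assume "j \<in> I"
      then show "trunc_ln \<epsilon> (a j \<bullet> v) = ln (a j \<bullet> v)"
        using \<epsilon>(2) \<mu>(3)[of j] by (simp add: trunc_ln_def)
    qed simp
    moreover have "(norm (x0 - v))\<^sup>2 / (2 * t) \<le> (norm (x0 - v))\<^sup>2 / (2 * s)"
      using t \<open>0 < s\<close> by (intro divide_left_mono) auto
    moreover have "energy \<epsilon> v - (norm (x0 - v))\<^sup>2 / (2 * t) \<le> energy \<epsilon> (x t)"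
      using energy_lower_bound[OF \<epsilon>(1) x, of t v] t \<open>0 < s\<close> by simp
    moreover have "energy \<epsilon> (x t) = trunc_ln \<epsilon> (a i \<bullet> x t) + (\<Sum>j\<in>I - {i}. trunc_ln \<epsilon> (a j \<bullet> x t))"
      unfolding energy_def by (rule sum.remove[OF finite_I i])
    moreover have "(\<Sum>j\<in>I - {i}. trunc_ln \<epsilon> (a j \<bullet> x t))
        \<le> (\<Sum>j\<in>I - {i}. norm (a j) * (norm x0 + sqrt (2 * real (card I) * T)))"
      by (intro sum_mono upper)
    \<comment> \<open>Adding back the nonnegative bound of the wall \<open>i\<close> makes
      \<open>A\<close> the same for every wall.\<close>
    moreover have "\<dots> \<le> (\<Sum>j\<in>I. norm (a j) * (norm x0 + sqrt (2 * real (card I) * T)))"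
      using finite_I t \<open>0 < s\<close> by (intro sum_mono2 mult_nonneg_nonneg add_nonneg_nonneg) auto
    ultimately have "A \<le> trunc_ln \<epsilon> (a i \<bullet> x t)"
      unfolding A_def by linarith
    then have "exp A \<le> a i \<bullet> x t"
      using ln_le_trunc_ln_imp_le[OF \<epsilon>(1), of "exp A"] \<epsilon>(2) by simp
    then show "min \<mu> (exp A) \<le> a i \<bullet> x t"
      by simp
  qed
qed

section \<open>Existence and uniqueness for the singular flow\<close>

lemma truncated_solution_exists:
  assumes "0 < \<epsilon>"
  shows "\<exists>x. solves (trunc_inverse \<epsilon>) x0 x"
  using lipschitz_ode_global_solution[OF drift_lipschitz[OF trunc_inverse_lipschitz[OF assms]]]
  unfolding solves_def by metis

text \<open>Contraction from time 0, where the distance is zero. It looks at the walls only at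
  interior times, so \<open>x0\<close> may lie on a wall.\<close>

lemma solution_unique:
  assumes x: "solves inverse x0 x" "\<And>i t. i \<in> I \<Longrightarrow> 0 < t \<Longrightarrow> 0 < a i \<bullet> x t"
    and y: "solves inverse x0 y" "\<And>i t. i \<in> I \<Longrightarrow> 0 < t \<Longrightarrow> 0 < a i \<bullet> y t"
    and "0 \<le> t"
  shows "y t = x t"
proof -
  have "continuous_on {0..t} x" "continuous_on {0..t} y"
    using x(1) y(1) by (auto simp: solves_def intro: continuous_on_subset)
  then have "norm (y t - x t) \<le> norm (y 0 - x 0)"
    using x y \<open>0 \<le> t\<close>
    by (intro drift_contraction[where f = inverse and S = "{0<..}"]) (auto simp: solves_def)
  then show ?thesis
    using x(1) y(1) by (simp add: solves_def)
qed

theorem solution_exists: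
  assumes v: "\<And>i. i \<in> I \<Longrightarrow> 0 < a i \<bullet> v"
    and x0: "\<And>i. i \<in> I \<Longrightarrow> 0 \<le> a i \<bullet> x0"
  obtains x where "solves inverse x0 x" "\<And>i t. i \<in> I \<Longrightarrow> 0 < t \<Longrightarrow> 0 < a i \<bullet> x t"
proof -
  define \<epsilon> where "\<epsilon> n = 1 / real (Suc n)" for n
  have \<epsilon>_pos: "0 < \<epsilon> n" for n
    by (simp add: \<epsilon>_def)
  have \<epsilon>_small: "\<exists>N. \<forall>n\<ge>N. \<epsilon> n \<le> \<delta>" if "0 < \<delta>" for \<delta>
  proof -
    obtain N where "inverse (real (Suc N)) < \<delta>"
      using reals_Archimedean[OF \<open>0 < \<delta>\<close>] by blast
    moreover have "\<epsilon> n \<le> inverse (real (Suc N))" if "N \<le> n" for n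
      using that by (simp add: \<epsilon>_def divide_simps)
    ultimately show ?thesis
      by (meson less_imp_le order_trans)
  qed
  have "\<exists>X. \<forall>n. solves (trunc_inverse (\<epsilon> n)) x0 (X n)"
    by (intro choice allI truncated_solution_exists \<epsilon>_pos)
  then obtain X where X: "\<And>n. solves (trunc_inverse (\<epsilon> n)) x0 (X n)"
    by blast
  have contX: "continuous_on S (X n)" if "S \<subseteq> {0..}" for n S
    using X that by (auto simp: solves_def intro: continuous_on_subset)
  have derX: "(X n has_vector_derivative drift (trunc_inverse (\<epsilon> n)) (X n t)) (at t)" if "0 < t" for n t
    using X that by (simp add: solves_def)
  \<comment> \<open>Once \<open>\<epsilon> n\<close> is at most the uniform gap \<delta>, truncating
    at \<open>\<epsilon> n\<close> or at \<delta> gives the same field along \<open>X n\<close>, so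
    all later \<open>X n\<close> solve one equation.\<close>
  have eventually_flow: "\<exists>\<delta>>0. \<exists>N. \<forall>n\<ge>N. (\<forall>t\<in>{s..T}. \<forall>i\<in>I. \<delta> \<le> a i \<bullet> X n t) \<and>
      (\<forall>t\<in>{s..T}. (X n has_vector_derivative drift (trunc_inverse \<delta>) (X n t)) (at t))"
    if "0 < s" for s T
  proof -
    obtain \<delta> where \<delta>: "0 < \<delta>"
      "\<And>\<epsilon> x t i. 0 < \<epsilon> \<Longrightarrow> \<epsilon> \<le> \<delta> \<Longrightarrow> solves (trunc_inverse \<epsilon>) x0 x \<Longrightarrow> s \<le> t \<Longrightarrow> t \<le> T
         \<Longrightarrow> i \<in> I \<Longrightarrow> \<delta> \<le> a i \<bullet> x t"
      using uniform_gap[OF v x0 \<open>0 < s\<close>] by metis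
    obtain N where N: "\<And>n. N \<le> n \<Longrightarrow> \<epsilon> n \<le> \<delta>"
      using \<epsilon>_small[OF \<delta>(1)] by blast
    have gap: "\<delta> \<le> a i \<bullet> X n t" if "N \<le> n" "t \<in> {s..T}" "i \<in> I" for n t i
      using \<delta>(2)[OF \<epsilon>_pos N X] that by simp
    have "drift (trunc_inverse (\<epsilon> n)) (X n t) = drift (trunc_inverse \<delta>) (X n t)"
      if "N \<le> n" "t \<in> {s..T}" for n t
    proof (rule drift_cong)
      fix i assume "i \<in> I"
      with that have "\<delta> \<le> a i \<bullet> X n t" "\<epsilon> n \<le> \<delta>"
        using gap N by auto
      then show "trunc_inverse (\<epsilon> n) (a i \<bullet> X n t) = trunc_inverse \<delta> (a i \<bullet> X n t)"
        by (simp add: trunc_inverse_eq)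
    qed
    then have "(X n has_vector_derivative drift (trunc_inverse \<delta>) (X n t)) (at t)"
      if "N \<le> n" "t \<in> {s..T}" for n t
      using derX[of t n] that \<open>0 < s\<close> by simp
    then show ?thesis
      using \<delta>(1) gap by blast
  qed
  have Cauchy: "uniformly_Cauchy_on {0..T} X" if "0 < T" for T
  proof (rule uniformly_Cauchy_onI)
    fix e :: real assume "0 < e"
    \<comment> \<open>Chosen so that every \<open>X n\<close> stays within \<open>e / 2\<close> of
      \<open>x0\<close> up to time \<open>s\<close>; the 1 in the denominator covers an empty
      \<open>I\<close>.\<close>
    define s where "s = e\<^sup>2 / (16 * (real (card I) + 1))"
    have s: "0 < s"
      using \<open>0 < e\<close> by (simp add: s_def)
    have "16 * (real (card I) + 1) * s = e\<^sup>2"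
      by (simp add: s_def add_nonneg_eq_0_iff)
    then have "16 * (real (card I) * s) + 16 * s = e\<^sup>2"
      by (simp add: algebra_simps)
    then have "2 * (real (card I) * s) < e\<^sup>2 / 4"
      using s zero_less_power[OF \<open>0 < e\<close>, of 2] by linarith
    then have "sqrt (2 * real (card I) * s) < e / 2"
      using \<open>0 < e\<close> by (intro real_less_lsqrt) (auto simp: power_divide mult.assoc)
    then have initial: "norm (X n t - X m t) < e" if "0 \<le> t" "t \<le> s" for n m t
    proof -
      have "norm (X k t - x0) < e / 2" for k
      proof -
        have "norm (X k t - x0) \<le> sqrt (2 * real (card I) * t)"
          by (rule dist_initial_le[OF \<epsilon>_pos X \<open>0 \<le> t\<close> x0])
        also have "\<dots> \<le> sqrt (2 * real (card I) * s)"
          using that by (intro real_sqrt_le_mono mult_left_mono) auto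
        finally show ?thesis
          using \<open>sqrt (2 * real (card I) * s) < e / 2\<close> by simp
      qed
      from this[of n] this[of m] show ?thesis
        using norm_triangle_ineq4[of "X n t - x0" "X m t - x0"] by simp
    qed
    obtain \<delta> N where \<delta>: "0 < \<delta>"
      and der: "\<And>n t. N \<le> n \<Longrightarrow> t \<in> {s..T} \<Longrightarrow>
        (X n has_vector_derivative drift (trunc_inverse \<delta>) (X n t)) (at t)"
      using eventually_flow[OF s, of T] by blast
    have "dist (X n t) (X m t) < e" if "N \<le> n" "N \<le> m" "t \<in> {0..T}" for n m t
    proof (cases "t \<le> s")
      case False
      \<comment> \<open>After time \<open>s\<close> both curves follow the field truncated at
        \<delta>, so their distance cannot exceed its value at \<open>s\<close>.\<close>
      have "norm (X n t - X m t) \<le> norm (X n s - X m s)"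
        using False s that der trunc_inverse_antimono[OF \<delta>]
        by (intro drift_contraction[where f = "trunc_inverse \<delta>" and S = UNIV] contX) auto
      also have "\<dots> < e"
        using initial s by simp
      finally show ?thesis
        by (simp add: dist_norm)
    qed (use initial that in \<open>simp add: dist_norm\<close>)
    then show "\<exists>M. \<forall>t\<in>{0..T}. \<forall>m\<ge>M. \<forall>n\<ge>M. dist (X m t) (X n t) < e"
      by blast
  qed
  define x where "x t = lim (\<lambda>n. X n t)" for t
  have unif: "uniform_limit {0..T} X x sequentially" if "0 < T" for T
    using Cauchy_uniformly_convergent[OF Cauchy[OF that]]
    unfolding x_def by (simp add: uniformly_convergent_uniform_limit_iff)
  have lim: "(\<lambda>n. X n t) \<longlonglongrightarrow> x t" if "0 \<le> t" for t
    using tendsto_uniform_limitI[OF unif[of "t + 1"], of t] that by simp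
  have cont: "continuous_on {0..} x"
  proof -
    have "continuous_on {0..T} x" if "0 < T" for T
      by (rule uniform_limit_theorem[OF _ unif[OF that]]) (auto intro!: always_eventually contX)
    then have "continuous (at t within {0..t + 1}) x" if "0 \<le> t" for t
      using that by (simp add: continuous_on_eq_continuous_within)
    moreover have "at t within {0..t + 1} = at t within {0..}" for t :: real
      by (rule at_within_nhd[of _ "{..<t + 1}"]) auto
    ultimately show ?thesis
      by (simp add: continuous_on_eq_continuous_within)
  qed
  have flow: "(\<forall>i\<in>I. 0 < a i \<bullet> x t) \<and> (x has_vector_derivative drift inverse (x t)) (at t)"
    if "0 < t" for t
  proof -
    let ?S = "{t / 2<..<2 * t}"
    obtain \<delta> N where \<delta>: "0 < \<delta>"
      and gap: "\<And>n r i. N \<le> n \<Longrightarrow> r \<in> {t / 2..2 * t} \<Longrightarrow> i \<in> I \<Longrightarrow> \<delta> \<le> a i \<bullet> X n r"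
      and der: "\<And>n r. N \<le> n \<Longrightarrow> r \<in> {t / 2..2 * t} \<Longrightarrow>
        (X n has_vector_derivative drift (trunc_inverse \<delta>) (X n r)) (at r)"
      using eventually_flow[of "t / 2" "2 * t"] half_gt_zero[OF \<open>0 < t\<close>] by blast
    have gapx: "\<delta> \<le> a i \<bullet> x t" if "i \<in> I" for i
    proof (rule LIMSEQ_le_const)
      show "(\<lambda>n. a i \<bullet> X n t) \<longlonglongrightarrow> a i \<bullet> x t"
        using lim \<open>0 < t\<close> by (intro tendsto_intros) auto
      show "\<exists>N. \<forall>n\<ge>N. \<delta> \<le> a i \<bullet> X n t"
        using gap[of _ t i] that \<open>0 < t\<close> by auto
    qed
    obtain L where L: "L-lipschitz_on UNIV (drift (trunc_inverse \<delta>))"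
      using drift_lipschitz[OF trunc_inverse_lipschitz[OF \<delta>]] by blast
    have "0 \<le> L"
      using L by (rule lipschitz_on_nonneg)
    have "t \<in> ?S"
      using \<open>0 < t\<close> by simp
    \<comment> \<open>Differentiation of a limit: the Lipschitz field carries uniform convergence of
      the curves over to their derivatives. The shift by \<open>N\<close> makes every curve solve
      the equation truncated at \<delta>.\<close>
    have "\<exists>g. \<forall>r\<in>?S. (\<lambda>n. X (n + N) r) \<longlonglongrightarrow> g r \<and>
        (g has_derivative (\<lambda>h. h *\<^sub>R drift (trunc_inverse \<delta>) (x r))) (at r within ?S)"
    proof (rule has_derivative_sequence[where ?x0.0 = t
          and f' = "\<lambda>n r h. h *\<^sub>R drift (trunc_inverse \<delta>) (X (n + N) r)"])
      show "(X (n + N) has_derivative (\<lambda>h. h *\<^sub>R drift (trunc_inverse \<delta>) (X (n + N) r))) (at r within ?S)"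
        if "r \<in> ?S" for n r
        using der[of "n + N" r] that
        by (auto simp: has_vector_derivative_def intro: has_derivative_at_withinI)
      show "t \<in> ?S"
        by fact
      show "(\<lambda>n. X (n + N) t) \<longlonglongrightarrow> x t"
        using LIMSEQ_ignore_initial_segment[OF lim] \<open>0 < t\<close> by simp
      fix e :: real assume "0 < e"
      \<comment> \<open>\<open>L + 1\<close> instead of \<open>L\<close> avoids division by
        zero.\<close>
      then have "0 < e / (L + 1)"
        using \<open>0 \<le> L\<close> by simp
      from uniform_limitD[OF unif[of "2 * t"] this]
      have "\<forall>\<^sub>F n in sequentially. \<forall>r\<in>{0..2 * t}. dist (X n r) (x r) < e / (L + 1)"
        using \<open>0 < t\<close> by simp
      then have "\<forall>\<^sub>F n in sequentially. \<forall>r\<in>{0..2 * t}. dist (X (n + N) r) (x r) < e / (L + 1)"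
        by (rule eventually_all_ge_at_top[THEN eventually_mono]) auto
      then show "\<forall>\<^sub>F n in sequentially. \<forall>r\<in>?S. \<forall>h.
          norm (h *\<^sub>R drift (trunc_inverse \<delta>) (X (n + N) r) - h *\<^sub>R drift (trunc_inverse \<delta>) (x r)) \<le> e * norm h"
      proof eventually_elim
        case (elim n)
        have "dist (drift (trunc_inverse \<delta>) (X (n + N) r)) (drift (trunc_inverse \<delta>) (x r)) \<le> e"
          if "r \<in> ?S" for r
        proof -
          have "dist (X (n + N) r) (x r) \<le> e / (L + 1)"
            using elim that \<open>0 < t\<close> by (auto intro: less_imp_le)
          then have "L * dist (X (n + N) r) (x r) \<le> L * (e / (L + 1))"
            using \<open>0 \<le> L\<close> by (rule mult_left_mono)
          also have "\<dots> \<le> e"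
            using \<open>0 \<le> L\<close> \<open>0 < e\<close> by (simp add: field_simps)
          finally show ?thesis
            using lipschitz_onD[OF L, of "X (n + N) r" "x r"] by simp
        qed
        then show ?case
          by (auto simp: dist_norm mult.commute[of e] simp flip: scaleR_right_diff_distrib
              intro!: mult_left_mono)
      qed
    qed (rule convex_real_interval)
    then obtain g where g: "\<And>r. r \<in> ?S \<Longrightarrow> (\<lambda>n. X (n + N) r) \<longlonglongrightarrow> g r"
      "(g has_derivative (\<lambda>h. h *\<^sub>R drift (trunc_inverse \<delta>) (x t))) (at t within ?S)"
      using \<open>t \<in> ?S\<close> by blast
    have "g r = x r" if "r \<in> ?S" for r
      using g(1)[OF that] LIMSEQ_ignore_initial_segment[OF lim, of r N] that \<open>0 < t\<close>
      by (auto intro: LIMSEQ_unique)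
    moreover have "(g has_vector_derivative drift (trunc_inverse \<delta>) (x t)) (at t)"
      using g(2) \<open>0 < t\<close> by (simp add: has_vector_derivative_def at_within_open[of t ?S])
    ultimately have "(x has_vector_derivative drift (trunc_inverse \<delta>) (x t)) (at t)"
      using \<open>0 < t\<close> by (auto intro: has_vector_derivative_transform_within_open[of g _ t ?S])
    \<comment> \<open>The limit inherits the gap \<delta>, so the truncation is inactive at
      \<open>x t\<close>.\<close>
    moreover have "drift (trunc_inverse \<delta>) (x t) = drift inverse (x t)"
      using gapx by (intro drift_cong) (simp add: trunc_inverse_eq inverse_eq_divide)
    ultimately show ?thesis
      using gapx \<delta> by (auto intro: less_le_trans)
  qed
  have "x 0 = x0"
    using LIMSEQ_unique[OF lim[of 0]] X by (auto simp: solves_def)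
  then show ?thesis
    using that[of x] cont flow by (simp add: solves_def)
qed

end

section \<open>The root system of type D\<close>

text \<open>An index \<open>((i, j), b)\<close> stands for the root \<open>e\<^sub>i + e\<^sub>j\<close> if \<open>b\<close> holds and for \<open>e\<^sub>i - e\<^sub>j\<close> otherwise.\<close>

definition D_index :: "(('n::linorder \<times> 'n::linorder) \<times> bool) set" where
  "D_index = {(i, j). i < j} \<times> UNIV"

definition D_root :: "('n::finite \<times> 'n::finite) \<times> bool \<Rightarrow> real ^ 'n::finite" where
  "D_root p = axis (fst (fst p)) 1 + (if snd p then 1 else - 1) *\<^sub>R axis (snd (fst p)) 1"

lemma D_root_inner:
  "D_root ((i, j), b) \<bullet> x = (if b then x $ i + x $ j else x $ i - x $ j)"
  by (simp add: D_root_def inner_add_left inner_axis')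

lemma D_root_nth:
  "D_root ((i, j), b) $ k = (if i = k then 1 else 0) + (if j = k then if b then 1 else - 1 else 0)"
  by (simp add: D_root_def axis_def)

lemma ball_D_index:
  "(\<forall>p\<in>D_index. P (D_root p \<bullet> x)) \<longleftrightarrow>
    (\<forall>i j. i < j \<longrightarrow> P (x $ i + x $ j) \<and> P (x $ i - x $ j))"
  by (auto simp: D_index_def D_root_inner all_bool_eq)

text \<open>Both sides amount to \<open>\<bar>x $ j\<bar> \<le> x $ i\<close> for all
  \<open>i < j\<close>. For \<open>j\<close> below the last index, the chain gives this because
  \<open>x $ j\<close> dominates an absolute value and is therefore nonnegative.\<close>

lemma weyl_chamber_D_iff:
  fixes x :: "real ^ 'n::{finite,linorder}"
  shows "x \<in> weyl_chamber_D \<longleftrightarrow> (\<forall>p\<in>D_index. 0 \<le> D_root p \<bullet> x)"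
proof
  assume x: "x \<in> weyl_chamber_D"
  have bound: "\<bar>x $ j\<bar> \<le> x $ i" if "i < j" for i j
  proof (cases "j = Max UNIV")
    case False
    then have "j < Max UNIV"
      by (simp add: order.not_eq_order_implies_strict)
    then have "x $ j \<le> x $ i" "\<bar>x $ Max UNIV\<bar> \<le> x $ j"
      using x that by (auto simp: weyl_chamber_D_def)
    then show ?thesis
      by linarith
  qed (use x that in \<open>auto simp: weyl_chamber_D_def\<close>)
  show "\<forall>p\<in>D_index. 0 \<le> D_root p \<bullet> x"
    unfolding ball_D_index
  proof (intro allI impI)
    fix i j :: 'n
    assume "i < j"
    then have "\<bar>x $ j\<bar> \<le> x $ i"
      by (rule bound)
    then show "0 \<le> x $ i + x $ j \<and> 0 \<le> x $ i - x $ j"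
      by (auto simp: abs_le_iff)
  qed
next
  assume "\<forall>p\<in>D_index. 0 \<le> D_root p \<bullet> x"
  then have "\<bar>x $ j\<bar> \<le> x $ i" if "i < j" for i j
    using that unfolding ball_D_index by (fastforce simp: abs_le_iff)
  then show "x \<in> weyl_chamber_D"
    by (auto simp: weyl_chamber_D_def abs_le_iff intro: less_trans)
qed

lemma open_weyl_chamber_D_iff:
  fixes x :: "real ^ 'n::{finite,linorder}"
  shows "x \<in> open_weyl_chamber_D \<longleftrightarrow> (\<forall>p\<in>D_index. 0 < D_root p \<bullet> x)"
proof
  assume x: "x \<in> open_weyl_chamber_D"
  have bound: "\<bar>x $ j\<bar> < x $ i" if "i < j" for i j
  proof (cases "j = Max UNIV")
    case False
    then have "j < Max UNIV"
      by (simp add: order.not_eq_order_implies_strict)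
    then have "x $ j < x $ i" "\<bar>x $ Max UNIV\<bar> < x $ j"
      using x that by (auto simp: open_weyl_chamber_D_def)
    then show ?thesis
      by linarith
  qed (use x that in \<open>auto simp: open_weyl_chamber_D_def\<close>)
  show "\<forall>p\<in>D_index. 0 < D_root p \<bullet> x"
    unfolding ball_D_index
  proof (intro allI impI)
    fix i j :: 'n
    assume "i < j"
    then have "\<bar>x $ j\<bar> < x $ i"
      by (rule bound)
    then show "0 < x $ i + x $ j \<and> 0 < x $ i - x $ j"
      by (auto simp: abs_less_iff)
  qed
next
  assume "\<forall>p\<in>D_index. 0 < D_root p \<bullet> x"
  then have "\<bar>x $ j\<bar> < x $ i" if "i < j" for i j
    using that unfolding ball_D_index by (fastforce simp: abs_less_iff)
  then show "x \<in> open_weyl_chamber_D"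
    by (auto simp: open_weyl_chamber_D_def abs_less_iff intro: less_trans)
qed

lemma open_weyl_chamber_D_nonempty: "open_weyl_chamber_D \<noteq> ({} :: (real ^ 'n::{finite,linorder}) set)"
proof -
  have "card {j..} < card {i..}" if "i < j" for i j :: 'n
    using that by (intro psubset_card_mono) auto
  \<comment> \<open>The point with coordinates N, N - 1, ..., 1.\<close>
  then have "(\<chi> i. real (card {i..})) \<in> (open_weyl_chamber_D :: (real ^ 'n::{finite,linorder}) set)"
    by (auto simp: open_weyl_chamber_D_def)
  then show ?thesis
    by blast
qed

interpretation D: root_flow "D_index :: (('n::{finite,linorder} \<times> 'n) \<times> bool) set" D_root
  by standard (simp add: D_index_def)

section \<open>Return from roots to coordinates\<close>

text \<open>Only pairs containing \<open>k\<close> contribute. Pairs with \<open>k\<close> first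
  give the sum over \<open>j > k\<close>, pairs with \<open>k\<close> second the sum over
  \<open>j < k\<close>.\<close>

lemma drift_D_nth:
  fixes x :: "real ^ 'n::{finite,linorder}"
  shows "D.drift inverse x $ k = (\<Sum>j\<in>UNIV - {k}. 1 / (x $ k - x $ j) + 1 / (x $ k + x $ j))"
proof -
  define P where "P = {(i, j :: 'n). i < j}"
  let ?g = "\<lambda>i j. inverse (x $ i - x $ j) + inverse (x $ i + x $ j)"
  have [simp]: "finite P"
    by simp
  have "D.drift inverse x $ k = (\<Sum>p\<in>P. \<Sum>b\<in>UNIV. inverse (D_root (p, b) \<bullet> x) * D_root (p, b) $ k)"
    unfolding D.drift_def by (simp add: D_index_def P_def sum.cartesian_product)
  also have "\<dots> = (\<Sum>(i, j)\<in>P. (if i = k then ?g k j else 0) + (if j = k then ?g k i else 0))"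
  proof (rule sum.cong)
    fix p assume "p \<in> P"
    then obtain i j where p: "p = (i, j)" "i < j"
      by (auto simp: P_def)
    \<comment> \<open>When \<open>k\<close> is the second index, this sign cancels the coefficient
      -1 of the root, so both positions yield the same summand. It also holds at coinciding
      coordinates, since \<open>inverse 0 = 0\<close>.\<close>
    have "inverse (x $ i - x $ j) = - inverse (x $ j - x $ i)"
      by (simp flip: inverse_minus_eq)
    then show "(\<Sum>b\<in>UNIV. inverse (D_root (p, b) \<bullet> x) * D_root (p, b) $ k)
        = (case p of (i, j) \<Rightarrow> (if i = k then ?g k j else 0) + (if j = k then ?g k i else 0))"
      using p by (auto simp: UNIV_bool D_root_inner D_root_nth add.commute)
  qed simp
  also have "\<dots> = (\<Sum>(i, j)\<in>P. if i = k then ?g k j else 0) + (\<Sum>(i, j)\<in>P. if j = k then ?g k i else 0)"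
    by (simp add: case_prod_beta sum.distrib)
  also have "(\<Sum>(i, j)\<in>P. if i = k then ?g k j else 0) = (\<Sum>j\<in>{k<..}. ?g k j)"
  proof -
    have "(\<Sum>(i, j)\<in>P. if i = k then ?g k j else 0) = (\<Sum>p\<in>(\<lambda>j. (k, j)) ` {k<..}. ?g k (snd p))"
      by (rule sum.mono_neutral_cong_right) (auto simp: P_def)
    then show ?thesis
      by (simp add: sum.reindex inj_on_def)
  qed
  also have "(\<Sum>(i, j)\<in>P. if j = k then ?g k i else 0) = (\<Sum>j\<in>{..<k}. ?g k j)"
  proof -
    have "(\<Sum>(i, j)\<in>P. if j = k then ?g k i else 0) = (\<Sum>p\<in>(\<lambda>j. (j, k)) ` {..<k}. ?g k (fst p))"
      by (rule sum.mono_neutral_cong_right) (auto simp: P_def)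
    then show ?thesis
      by (simp add: sum.reindex inj_on_def)
  qed
  also have "(\<Sum>j\<in>{k<..}. ?g k j) + (\<Sum>j\<in>{..<k}. ?g k j) = (\<Sum>j\<in>{k<..} \<union> {..<k}. ?g k j)"
    by (rule sum.union_disjoint[symmetric]) auto
  also have "{k<..} \<union> {..<k} = UNIV - {k}"
    by auto
  finally show ?thesis
    by (simp add: inverse_eq_divide[of "_ - _"] inverse_eq_divide[of "_ + _"])
qed

lemma has_vector_derivative_vec_iff:
  fixes x :: "real \<Rightarrow> real ^ 'n"
  shows "(x has_vector_derivative d) (at t) \<longleftrightarrow> (\<forall>i. ((\<lambda>s. x s $ i) has_real_derivative d $ i) (at t))"
proof -
  have "(x has_vector_derivative d) (at t) \<longleftrightarrow>
      (\<forall>b\<in>Basis. ((\<lambda>s. x s \<bullet> b) has_derivative (\<lambda>h. (h *\<^sub>R d) \<bullet> b)) (at t))"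
    unfolding has_vector_derivative_def by (rule has_derivative_componentwise_within)
  also have "\<dots> \<longleftrightarrow>
      (\<forall>i. ((\<lambda>s. x s \<bullet> axis i 1) has_derivative (\<lambda>h. (h *\<^sub>R d) \<bullet> axis i 1)) (at t))"
    by (auto simp: Basis_vec_def)
  also have "\<dots> \<longleftrightarrow> (\<forall>i. ((\<lambda>s. x s $ i) has_real_derivative d $ i) (at t))"
    by (simp add: inner_axis has_field_derivative_def mult_commute_abs)
  finally show ?thesis .
qed

text \<open>Membership in the closed chamber is recovered at time 0 from the assumption on
  \<open>x0\<close> and at positive times from the open chamber.\<close>

lemma is_D_solution_iff:
  fixes x0 :: "real ^ 'n::{finite,linorder}"
  assumes "x0 \<in> weyl_chamber_D"
  shows "is_D_solution x0 x \<longleftrightarrow>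
    D.solves inverse x0 x \<and> (\<forall>p\<in>D_index. \<forall>t>0. 0 < D_root p \<bullet> x t)"
proof -
  have "y \<in> weyl_chamber_D" if "y \<in> open_weyl_chamber_D" for y :: "real ^ 'n::{finite,linorder}"
    using that unfolding open_weyl_chamber_D_iff weyl_chamber_D_iff by (meson less_imp_le)
  then have closed: "x t \<in> weyl_chamber_D" if "x 0 = x0" "\<forall>t>0. x t \<in> open_weyl_chamber_D" "0 \<le> t" for t
    using that assms by (cases "t = 0") auto
  have "is_D_solution x0 x \<longleftrightarrow> continuous_on {0..} x \<and> (\<forall>t\<ge>0. x t \<in> weyl_chamber_D) \<and> x 0 = x0
      \<and> (\<forall>t>0. x t \<in> open_weyl_chamber_D)
      \<and> (\<forall>t>0. (x has_vector_derivative D.drift inverse (x t)) (at t))"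
    by (simp only: is_D_solution_def has_vector_derivative_vec_iff drift_D_nth)
  also have "\<dots> \<longleftrightarrow> D.solves inverse x0 x \<and> (\<forall>t>0. x t \<in> open_weyl_chamber_D)"
    unfolding D.solves_def using closed by blast
  also have "\<dots> \<longleftrightarrow> D.solves inverse x0 x \<and> (\<forall>p\<in>D_index. \<forall>t>0. 0 < D_root p \<bullet> x t)"
    unfolding open_weyl_chamber_D_iff by blast
  finally show ?thesis .
qed

theorem theorem4p6:
  fixes x0 :: "real ^ 'n::{finite,linorder}"
  assumes "CARD('n) \<ge> 2"
    and "x0 \<in> weyl_chamber_D"
  shows "\<exists>x. is_D_solution x0 x \<and>
             (\<forall>y. is_D_solution x0 y \<longrightarrow> (\<forall>t\<ge>0. y t = x t))"
proof -
  \<comment> \<open>An interior point serves as the comparison point of the energy estimate.\<close>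
  obtain v :: "real ^ 'n::{finite,linorder}" where v: "v \<in> open_weyl_chamber_D"
    using open_weyl_chamber_D_nonempty by blast
  obtain x where "D.solves inverse x0 x" "\<And>p t. p \<in> D_index \<Longrightarrow> 0 < t \<Longrightarrow> 0 < D_root p \<bullet> x t"
    using D.solution_exists[of v x0] v assms(2)
    unfolding open_weyl_chamber_D_iff weyl_chamber_D_iff by blast
  then show ?thesis
    unfolding is_D_solution_iff[OF assms(2)] using D.solution_unique[of x0 x] by blast
qed

end
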